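(* Let $\phi:\mathbb{R}^n\to\mathbb{R}$ be continuously differentiable, let $A\in\mathbb{R}^{m\times n}$ have full row rank, let $b\in\mathbb{R}^m$, and suppose $\{x\in\mathbb{R}^n_+ : Ax=b\}\neq\emptyset$. Let $\mathcal{P}_{A,b}=\{y\in\mathbb{R}^n : A(y\circ y)=b\}$ and $f(y)=\phi(y\circ y)$. Suppose $y\in\mathcal{P}_{A,b}$ has regular representation $(M,N,r)$ and let $x=y\circ y$. Then $y$ is a first-order stationary point of $\min\{f(y): y\in\mathcal{P}_{A,b}\}$ if and only if there exists $\lambda\in\mathbb{R}^r$ such that $$(\nabla\phi(x)-A^\top M^\top\lambda)\circ y=0,$$ which is equivalent to $\nabla\phi(x)\circ y\in\mathrm{Range}[D_yA^\top]$, i.e., to $\mathrm{Proj}_{\mathrm{Ker}[AD_y]}(\nabla\phi(x)\circ y)=0$.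
   Context: $\circ$ denotes the entrywise (Hadamard) product, $D_y=\mathrm{Diag}(y)$, and $\mathrm{Proj}_{\mathcal{C}}$ is the Euclidean orthogonal projection onto $\mathcal{C}$. Regular representation: for $y\in\mathcal{P}_{A,b}$, a triple $(M,N,r)$ is a regular representation of $y$ if $r=\mathrm{rank}(AD_y)$, $M\in\mathbb{R}^{r\times m}$ has rows forming a basis of $\mathrm{Range}[AD_y]\subset\mathbb{R}^m$, and $N\in\mathbb{R}^{(m-r)\times m}$ has rows forming a basis of the orthogonal complement of $\mathrm{Range}[AD_y]$ in $\mathbb{R}^m$. First-order stationary point: $y$ is a first-order stationary point of $\min\{f(y): y\in\mathcal{P}_{A,b}\}$ if $y\in\mathcal{P}_{A,b}$ and $\nabla f(y)^\top h\ge 0$ for all $h\in\mathcal{T}_{\mathcal{P}_{A,b}}(y)$, where for a closed set $S$ and $x\in S$ the contingent tangent cone is $\mathcal{T}_S(x)=\{h : \exists\, t_k\downarrow 0,\ \mathrm{dist}(x+t_kh,S)=o(t_k)\}$. *)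

theory Defs
  imports "HOL-Analysis.Analysis" "HOL-Library.Landau_Symbols"
begin

text \<open>
  Vectors are elements of \<open>real ^ 'n\<close> and matrices elements of \<open>real ^ 'n ^ 'm\<close>. The library's
  multiplication \<open>x * y\<close> on \<open>real ^ 'n\<close> acts componentwise, so it is the Hadamard product.
\<close>

definition grad :: "('a::real_inner \<Rightarrow> real) \<Rightarrow> 'a \<Rightarrow> 'a" where
  "grad f x = (THE D. GDERIV f x :> D)"

lemma grad_eqI:
  assumes "GDERIV f x :> D"
  shows "grad f x = D"
  unfolding grad_def
proof (rule the_equality)
  show "GDERIV f x :> D" by (rule assms)
next
  fix E assume "GDERIV f x :> E"
  then have "(\<lambda>h. inner h E) = (\<lambda>h. inner h D)"
    using assms unfolding gderiv_def by (rule has_derivative_unique)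
  then have "inner (E - D) E = inner (E - D) D"
    by (rule fun_cong)
  then have "inner (E - D) (E - D) = 0"
    by (simp add: inner_diff_right)
  then show "E = D" by simp
qed

lemma GDERIV_grad:
  fixes f :: "'a::euclidean_space \<Rightarrow> real"
  assumes "f differentiable (at x)"
  shows "GDERIV f x :> grad f x"
proof -
  obtain f' where f': "(f has_derivative f') (at x)"
    using assms by (auto simp: differentiable_def)
  then have lin: "linear f'"
    by (rule has_derivative_linear)
  have "f' = (\<lambda>h. inner h (adjoint f' 1))"
  proof
    show "f' h = inner h (adjoint f' 1)" for h
      using adjoint_works[OF lin, of h 1] by simp
  qed
  with f' have "(f has_derivative (\<lambda>h. inner h (adjoint f' 1))) (at x)"
    by (rule has_derivative_eq_rhs)
  then have *: "GDERIV f x :> adjoint f' 1"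
    unfolding gderiv_def .
  show ?thesis
    unfolding grad_eqI[OF *] by (rule *)
qed

definition continuously_differentiable :: "('a::euclidean_space \<Rightarrow> real) \<Rightarrow> bool" where
  "continuously_differentiable f \<longleftrightarrow>
     (\<forall>x. f differentiable (at x)) \<and> continuous_on UNIV (grad f)"

definition Diag :: "real ^ 'n \<Rightarrow> real ^ 'n ^ 'n" where
  "Diag y = (\<chi> i j. if i = j then y $ i else 0)"

definition P_set :: "real ^ 'n ^ 'm \<Rightarrow> real ^ 'm \<Rightarrow> (real ^ 'n) set" where
  "P_set A b = {y. A *v (y * y) = b}"

abbreviation mat_range :: "real ^ 'n ^ 'm \<Rightarrow> (real ^ 'm) set" where
  "mat_range B \<equiv> range (\<lambda>v. B *v v)"

definition mat_kernel :: "real ^ 'n ^ 'm \<Rightarrow> (real ^ 'n) set" where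
  "mat_kernel B = {v. B *v v = 0}"

text \<open>
  The number of rows \<open>r\<close> or \<open>m - r\<close> of the matrices in a regular representation depends on the
  point and may be zero, whereas index types are never empty. Such a matrix is therefore given
  by its rows \<open>M 0, \<dots>, M (r - 1)\<close>; the values of \<open>M\<close> at indices \<open>\<ge> r\<close> are irrelevant. Likewise
  a vector in \<open>\<real>\<^sup>r\<close> is given by its entries at the indices \<open>< r\<close>.
\<close>

definition rows_form_basis :: "nat \<Rightarrow> (nat \<Rightarrow> real ^ 'm) \<Rightarrow> (real ^ 'm) set \<Rightarrow> bool" where
  "rows_form_basis r M V \<longleftrightarrow>
     inj_on M {..<r} \<and> independent (M ` {..<r}) \<and> span (M ` {..<r}) = V"

text \<open>The product \<open>M\<^sup>T lam\<close> for \<open>M\<close> with \<open>r\<close> rows.\<close>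

definition transpose_rows_mult :: "nat \<Rightarrow> (nat \<Rightarrow> real ^ 'm) \<Rightarrow> (nat \<Rightarrow> real) \<Rightarrow> real ^ 'm" where
  "transpose_rows_mult r M lam = (\<Sum>i<r. lam i *\<^sub>R M i)"

definition regular_representation ::
    "real ^ 'n ^ 'm \<Rightarrow> real ^ 'n \<Rightarrow> (nat \<Rightarrow> real ^ 'm) \<Rightarrow> (nat \<Rightarrow> real ^ 'm) \<Rightarrow> nat \<Rightarrow> bool" where
  "regular_representation A y M N r \<longleftrightarrow>
     r = rank (A ** Diag y) \<and>
     rows_form_basis r M (mat_range (A ** Diag y)) \<and>
     rows_form_basis (CARD('m) - r) N ((mat_range (A ** Diag y))\<^sup>\<bottom>)"

definition contingent_cone :: "'a::euclidean_space set \<Rightarrow> 'a \<Rightarrow> 'a set" where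
  "contingent_cone S x =
     {h. \<exists>t :: nat \<Rightarrow> real. (\<forall>k. t k > 0) \<and> t \<longlonglongrightarrow> 0 \<and>
           (\<lambda>k. infdist (x + t k *\<^sub>R h) S) \<in> o(t)}"

definition first_order_stationary ::
    "('a::euclidean_space \<Rightarrow> real) \<Rightarrow> 'a set \<Rightarrow> 'a \<Rightarrow> bool" where
  "first_order_stationary f S y \<longleftrightarrow>
     y \<in> S \<and> (\<forall>h \<in> contingent_cone S y. inner (grad f y) h \<ge> 0)"

end

theory Submission
  imports Defs
begin

text \<open>
  Write \<open>g = \<nabla>\<phi>(x) \<circ> y\<close> and \<open>B = A D\<^sub>y\<close>, so that \<open>\<nabla>f(y) = 2 g\<close>. Every contingent direction lies
  in \<open>Ker B\<close>, so \<open>g \<in> Range B\<^sup>T = (Ker B)\<^sup>\<bottom>\<close> implies stationarity. Conversely, let \<open>h \<in> Ker B\<close>. Although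
  \<open>h\<close> need not be tangent when \<open>B\<close> is rank deficient, its restriction to the support of \<open>y\<close> is: the
  constraint is linear in the squares, so changing \<open>y\<^sub>i\<^sup>2\<close> into \<open>y\<^sub>i\<^sup>2 + 2 t y\<^sub>i h\<^sub>i\<close> and taking roots
  (with the sign of \<open>y\<^sub>i\<close>) gives an exactly feasible curve with that velocity. As \<open>g\<close> vanishes off
  the support of \<open>y\<close>, stationarity applied to \<open>h\<close> and \<open>- h\<close> yields \<open>g \<bullet> h = 0\<close>.
\<close>

section \<open>Ranges, kernels and projections\<close>

lemma mat_kernel_eq_orthogonal_comp:
  fixes B :: "real ^ 'n ^ 'm"
  shows "mat_kernel B = (mat_range (transpose B))\<^sup>\<bottom>"
proof -
  have "mat_kernel B = (\<lambda>v. B *v v) -` {0}"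
    by (auto simp: mat_kernel_def)
  then show ?thesis
    by (simp add: ker_orthogonal_comp_adjoint matrix_vector_mul_linear adjoint_matrix)
qed

lemma subspace_mat_range: "subspace (mat_range (B :: real ^ 'n ^ 'm))"
  by (intro linear_subspace_image matrix_vector_mul_linear subspace_UNIV)

lemma mat_range_transpose_eq_orthogonal_comp:
  fixes B :: "real ^ 'n ^ 'm"
  shows "mat_range (transpose B) = (mat_kernel B)\<^sup>\<bottom>"
  unfolding mat_kernel_eq_orthogonal_comp
  by (rule orthogonal_comp_self[OF subspace_mat_range, symmetric])

text \<open>The part of \<open>v\<close> orthogonal to the range of \<open>B\<close> is annihilated
  by \<open>transpose B\<close>. This is why multipliers of the form
  \<open>transpose_rows_mult r M lam\<close>, which only reach the range of
  \<open>A ** Diag y\<close>, are as good as arbitrary vectors.\<close>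

lemma transpose_image_mat_range:
  fixes B :: "real ^ 'n ^ 'm"
  shows "(\<lambda>v. transpose B *v v) ` mat_range B = mat_range (transpose B)"
proof (intro equalityI subsetI)
  fix u assume "u \<in> mat_range (transpose B)"
  then obtain v where u: "u = transpose B *v v" by auto
  obtain p q where p: "p \<in> span (mat_range B)" and q: "\<And>w. w \<in> span (mat_range B) \<Longrightarrow> orthogonal q w"
    and v: "v = p + q"
    using orthogonal_subspace_decomp_exists[of "mat_range B" v] by metis
  have "q \<in> mat_kernel (transpose B)"
    unfolding mat_kernel_eq_orthogonal_comp orthogonal_comp_def
    using q by (auto simp: transpose_transpose orthogonal_commute[of _ q] span_base simp del: transpose_matrix_vector)
  then have "u = transpose B *v p"
    by (simp add: u v mat_kernel_def matrix_vector_right_distrib)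
  moreover have "p \<in> mat_range B"
    using p subspace_mat_range by (metis span_eq_iff)
  ultimately show "u \<in> (\<lambda>v. transpose B *v v) ` mat_range B" by blast
qed auto

lemma closest_point_subspace_eq_0_iff:
  fixes S :: "'a::euclidean_space set"
  assumes "subspace S"
  shows "closest_point S a = 0 \<longleftrightarrow> a \<in> S\<^sup>\<bottom>"
proof
  assume 0: "closest_point S a = 0"
  \<comment> \<open>This is the variational inequality of the projection at the point 0; applying it
    to \<open>- s\<close> as well turns it into an equality.\<close>
  have le: "inner a s \<le> 0" if "s \<in> S" for s
    using closest_point_dot[of S s a] assms that 0
    by (simp add: subspace_imp_convex closed_subspace)
  have "inner s a = 0" if "s \<in> S" for s
    using le[OF that] le[of "- s"] assms that by (simp add: subspace_neg inner_commute)
  then show "a \<in> S\<^sup>\<bottom>"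
    by (simp add: orthogonal_comp_def orthogonal_def)
next
  assume a: "a \<in> S\<^sup>\<bottom>"
  have "dist a 0 \<le> dist a s" if "s \<in> S" for s
  proof -
    have "orthogonal a (- s)"
      using a that by (auto simp: orthogonal_comp_def orthogonal_def inner_commute)
    then have "(norm (a - s))\<^sup>2 = (norm a)\<^sup>2 + (norm s)\<^sup>2"
      using norm_add_Pythagorean[of a "- s"] by simp
    then have "(norm a)\<^sup>2 \<le> (norm (a - s))\<^sup>2" by simp
    then show ?thesis
      by (simp add: dist_norm)
  qed
  then show "closest_point S a = 0"
    using closest_point_unique[of S 0 a] assms
    by (simp add: subspace_imp_convex closed_subspace subspace_0)
qed

lemma span_image_lessThan_eq_range_sum:
  fixes M :: "nat \<Rightarrow> 'a::real_vector"
  assumes "inj_on M {..<r}"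
  shows "span (M ` {..<r}) = range (\<lambda>lam. \<Sum>i<r. lam i *\<^sub>R M i)"
proof -
  have "(\<Sum>v\<in>M ` {..<r}. u v *\<^sub>R v) = (\<Sum>i<r. u (M i) *\<^sub>R M i)" for u
    by (simp add: sum.reindex[OF assms])
  then have "span (M ` {..<r}) \<subseteq> range (\<lambda>lam. \<Sum>i<r. lam i *\<^sub>R M i)"
    by (auto simp: span_finite)
  moreover have "(\<Sum>i<r. lam i *\<^sub>R M i) \<in> span (M ` {..<r})" for lam
    by (intro span_sum span_scale span_base) simp
  ultimately show ?thesis by blast
qed

section \<open>The contingent cone\<close>

text \<open>Sample the curve along a positive null sequence: the distance of
  \<open>x + t k *\<^sub>R h\<close> to \<open>S\<close> is at most its distance to the feasible
  point \<open>c (t k)\<close>, which is \<open>o(t)\<close> because \<open>h\<close> is the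
  right-hand velocity.\<close>

lemma contingent_coneI_curve:
  fixes c :: "real \<Rightarrow> 'a::euclidean_space"
  assumes deriv: "((\<lambda>t. (c t - x) /\<^sub>R t) \<longlongrightarrow> h) (at_right 0)"
    and feas: "\<forall>\<^sub>F t in at_right 0. c t \<in> S"
  shows "h \<in> contingent_cone S x"
proof -
  define t where "t k = inverse (real (Suc k))" for k
  have pos: "t k > 0" for k by (simp add: t_def)
  have t0: "t \<longlonglongrightarrow> 0"
    unfolding t_def by (rule LIMSEQ_inverse_real_of_nat)
  have tr: "filterlim t (at_right 0) sequentially"
    using t0 by (rule tendsto_imp_filterlim_at_right) (simp add: pos)
  have "(\<lambda>k. (c (t k) - x) /\<^sub>R t k) \<longlonglongrightarrow> h"
    using deriv tr by (rule filterlim_compose)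
  then have lim: "(\<lambda>k. norm ((c (t k) - x) /\<^sub>R t k - h)) \<longlonglongrightarrow> 0"
    using tendsto_norm_zero LIM_zero by blast
  have "\<forall>\<^sub>F k in sequentially. c (t k) \<in> S"
    using feas tr by (rule eventually_compose_filterlim)
  then have "\<forall>\<^sub>F k in sequentially.
      norm (infdist (x + t k *\<^sub>R h) S / t k) \<le> norm ((c (t k) - x) /\<^sub>R t k - h)"
  proof eventually_elim
    case (elim k)
    have "(c (t k) - x) /\<^sub>R t k - h = (c (t k) - (x + t k *\<^sub>R h)) /\<^sub>R t k"
      using pos[of k] by (simp add: algebra_simps)
    then have "norm ((c (t k) - x) /\<^sub>R t k - h) = dist (x + t k *\<^sub>R h) (c (t k)) / t k"
      using pos[of k] by (simp add: dist_norm norm_minus_commute divide_inverse)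
    moreover have "infdist (x + t k *\<^sub>R h) S \<le> dist (x + t k *\<^sub>R h) (c (t k))"
      using elim by (rule infdist_le)
    ultimately show ?case
      using pos[of k] by (simp add: infdist_nonneg divide_right_mono)
  qed
  then have "(\<lambda>k. infdist (x + t k *\<^sub>R h) S / t k) \<longlonglongrightarrow> 0"
    using lim by (rule Lim_null_comparison)
  then have "(\<lambda>k. infdist (x + t k *\<^sub>R h) S) \<in> o(t)"
    using pos by (intro smalloI_tendsto) (auto simp: less_imp_neq[symmetric])
  with pos t0 show ?thesis
    unfolding contingent_cone_def by blast
qed

text \<open>Replacing each \<open>x + t k *\<^sub>R h\<close> by a nearest point of the closed set
  gives exactly feasible points, at the price of perturbing the direction by a null
  sequence.\<close>

lemma contingent_coneE:
  assumes h: "h \<in> contingent_cone S x" and "closed S" "S \<noteq> {}"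
  obtains t d where "\<And>k. t k > 0" "t \<longlonglongrightarrow> 0" "d \<longlonglongrightarrow> h" "\<And>k. x + t k *\<^sub>R d k \<in> S"
proof -
  obtain t where pos: "\<And>k. t k > 0" and t0: "t \<longlonglongrightarrow> 0"
    and o: "(\<lambda>k. infdist (x + t k *\<^sub>R h) S) \<in> o(t)"
    using h unfolding contingent_cone_def by blast
  have "\<exists>z\<in>S. infdist (x + t k *\<^sub>R h) S = dist (x + t k *\<^sub>R h) z" for k
    using infdist_attains_inf[OF assms(2,3)] by metis
  then obtain z where z: "\<And>k. z k \<in> S"
    "\<And>k. infdist (x + t k *\<^sub>R h) S = dist (x + t k *\<^sub>R h) (z k)" by metis
  define d where "d k = (z k - x) /\<^sub>R t k" for k
  have "x + t k *\<^sub>R d k \<in> S" for k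
    using z(1)[of k] pos[of k] by (simp add: d_def)
  moreover have "infdist (x + t k *\<^sub>R h) S / t k = norm (d k - h)" for k
  proof -
    have "d k - h = (z k - (x + t k *\<^sub>R h)) /\<^sub>R t k"
      using pos[of k] by (simp add: d_def algebra_simps)
    then show ?thesis
      using pos[of k] by (simp add: z(2) dist_norm norm_minus_commute divide_inverse)
  qed
  then have "(\<lambda>k. norm (d k - h)) \<longlonglongrightarrow> 0"
    using smalloD_tendsto[OF o] by simp
  then have "d \<longlonglongrightarrow> h"
    by (rule LIM_zero_cancel[OF tendsto_norm_zero_cancel])
  ultimately show ?thesis
    using that pos t0 by blast
qed

section \<open>The feasible set and the objective\<close>

lemma bounded_bilinear_vec_mult: "bounded_bilinear ((*) :: real ^ 'n \<Rightarrow> real ^ 'n \<Rightarrow> real ^ 'n)"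
  unfolding bilinear_conv_bounded_bilinear[symmetric] bilinear_def
  by (auto intro!: linearI simp: algebra_simps)

lemma Diag_mult_vec: "Diag y *v v = y * v"
  by (simp add: vec_eq_iff Diag_def matrix_vector_mult_def if_distrib[of "\<lambda>a. a * _"] cong: if_cong)

lemma transpose_Diag: "transpose (Diag y) = Diag y"
  by (simp add: vec_eq_iff Diag_def transpose_def)

lemma mult_Diag_mult_vec: "(A ** Diag y) *v v = A *v (y * v)"
  by (simp add: matrix_vector_mul_assoc[symmetric] Diag_mult_vec)

lemma closed_P_set: "closed (P_set A b)"
proof -
  have "isCont (\<lambda>y. A *v (y * y)) y" for y
    by (intro bounded_linear.isCont[OF matrix_vector_mul_bounded_linear]
        bounded_bilinear.isCont[OF bounded_bilinear_vec_mult] continuous_ident)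
  then have "closed ((\<lambda>y. A *v (y * y)) -` {b})"
    by (intro continuous_closed_vimage) auto
  then show ?thesis
    by (simp add: P_set_def vimage_def)
qed

lemma contingent_cone_P_set_subset:
  assumes "y \<in> P_set A b"
  shows "contingent_cone (P_set A b) y \<subseteq> mat_kernel (A ** Diag y)"
proof
  fix h assume "h \<in> contingent_cone (P_set A b) y"
  then obtain t d where pos: "\<And>k. t k > 0" and t0: "t \<longlonglongrightarrow> 0" and d: "d \<longlonglongrightarrow> h"
    and feas: "\<And>k. y + t k *\<^sub>R d k \<in> P_set A b"
    using assms closed_P_set contingent_coneE by (metis empty_iff)
  \<comment> \<open>The difference quotient of the quadratic constraint along \<open>d k\<close>,
    written without division so that its limit is immediate.\<close>
  let ?q = "\<lambda>k. A *v (d k * (2 *\<^sub>R y + t k *\<^sub>R d k))"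
  have "(y + t k *\<^sub>R d k) * (y + t k *\<^sub>R d k) = y * y + t k *\<^sub>R (d k * (2 *\<^sub>R y + t k *\<^sub>R d k))" for k
    by (simp add: algebra_simps scaleR_2)
  then have "t k *\<^sub>R ?q k = 0" for k
    using feas[of k] assms
    by (simp add: P_set_def matrix_vector_right_distrib matrix_vector_mult_scaleR)
  then have "?q k = 0" for k
    using pos[of k] by (metis less_irrefl scaleR_eq_0_iff)
  moreover have "?q \<longlonglongrightarrow> A *v (h * (2 *\<^sub>R y + 0 *\<^sub>R h))"
    by (intro bounded_linear.tendsto[OF matrix_vector_mul_bounded_linear]
        bounded_bilinear.tendsto[OF bounded_bilinear_vec_mult] tendsto_intros d t0)
  ultimately have "A *v (h * (2 *\<^sub>R y)) = 0"
    using LIMSEQ_unique[OF tendsto_const] by force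
  then show "h \<in> mat_kernel (A ** Diag y)"
    by (simp add: mat_kernel_def mult_Diag_mult_vec matrix_vector_mult_scaleR mult.commute)
qed

text \<open>The squares of the curve move linearly in the direction
  \<open>2 *\<^sub>R (y * h)\<close>, which \<open>A\<close> maps to 0 since \<open>h\<close> is in
  the kernel. The constraint therefore holds exactly, and no constraint qualification
  enters.\<close>

lemma restrict_support_in_contingent_cone:
  fixes A :: "real ^ 'n ^ 'm"
  assumes y: "y \<in> P_set A b" and h: "h \<in> mat_kernel (A ** Diag y)"
  shows "(\<chi> i. if y $ i = 0 then 0 else h $ i) \<in> contingent_cone (P_set A b) y"
proof (rule contingent_coneI_curve)
  \<comment> \<open>The factor \<open>sgn (y $ i)\<close> selects the root that equals
    \<open>y $ i\<close> at \<open>t = 0\<close>; as \<open>sgn 0 = 0\<close>, coordinates off the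
    support stay at 0.\<close>
  define c where "c t = (\<chi> i. sgn (y $ i) * sqrt ((y $ i)\<^sup>2 + 2 * t * y $ i * h $ i))" for t
  show "((\<lambda>t. (c t - y) /\<^sub>R t) \<longlongrightarrow> (\<chi> i. if y $ i = 0 then 0 else h $ i)) (at_right 0)"
  proof (rule vec_tendstoI)
    fix i
    show "((\<lambda>t. ((c t - y) /\<^sub>R t) $ i) \<longlongrightarrow> (\<chi> i. if y $ i = 0 then 0 else h $ i) $ i) (at_right 0)"
    proof (cases "y $ i = 0")
      case False
      \<comment> \<open>The radicand is positive at 0, so the root is differentiable there, with
        derivative
        \<open>sgn (y $ i) * (2 * y $ i * h $ i) / (2 * \<bar>y $ i\<bar>)\<close>.\<close>
      have "((\<lambda>t. c t $ i) has_real_derivative h $ i) (at 0)"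
        unfolding c_def vec_lambda_beta using False
        by (auto intro!: derivative_eq_intros simp: sgn_real_def field_simps)
      then have "((\<lambda>t. (c t $ i - c 0 $ i) / (t - 0)) \<longlongrightarrow> h $ i) (at 0)"
        by (simp add: has_field_derivative_iff)
      moreover have "c 0 $ i = y $ i"
        by (simp add: c_def sgn_mult_abs)
      ultimately have "((\<lambda>t. ((c t - y) /\<^sub>R t) $ i) \<longlongrightarrow> h $ i) (at 0)"
        by (simp add: divide_inverse mult.commute)
      then show ?thesis
        using False by (simp add: filterlim_at_split)
    qed (simp add: c_def)
  qed
  \<comment> \<open>Needed for the root to square back to the radicand. Off the support the radicand
    is identically 0.\<close>
  have "\<forall>\<^sub>F t in at_right 0. 0 \<le> (y $ i)\<^sup>2 + 2 * t * y $ i * h $ i" for i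
  proof (cases "y $ i = 0")
    case False
    have "((\<lambda>t. (y $ i)\<^sup>2 + 2 * t * y $ i * h $ i) \<longlongrightarrow> (y $ i)\<^sup>2 + 2 * 0 * y $ i * h $ i) (at_right 0)"
      by (intro tendsto_intros)
    then have "\<forall>\<^sub>F t in at_right 0. 0 < (y $ i)\<^sup>2 + 2 * t * y $ i * h $ i"
      by (rule order_tendstoD) (use False in simp)
    then show ?thesis
      by (rule eventually_mono) simp
  qed simp
  then have "\<forall>\<^sub>F t in at_right 0. \<forall>i. 0 \<le> (y $ i)\<^sup>2 + 2 * t * y $ i * h $ i"
    by (rule eventually_all_finite)
  then show "\<forall>\<^sub>F t in at_right 0. c t \<in> P_set A b"
  proof eventually_elim
    case (elim t)
    have "c t * c t = y * y + (2 * t) *\<^sub>R (y * h)"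
    proof (rule vec_eq_iff[THEN iffD2, rule_format])
      fix i
      have "(c t * c t) $ i = (sgn (y $ i) * sgn (y $ i)) * ((y $ i)\<^sup>2 + 2 * t * y $ i * h $ i)"
        using elim[rule_format, of i] by (simp add: c_def algebra_simps)
      then show "(c t * c t) $ i = (y * y + (2 * t) *\<^sub>R (y * h)) $ i"
        by (simp add: sgn_real_def power2_eq_square)
    qed
    then show ?case
      using y h
      by (simp add: P_set_def mat_kernel_def mult_Diag_mult_vec matrix_vector_right_distrib
          matrix_vector_mult_scaleR)
  qed
qed

lemma grad_comp_square:
  fixes \<phi> :: "real ^ 'n \<Rightarrow> real"
  assumes "\<phi> differentiable (at (y * y))"
  shows "grad (\<lambda>z. \<phi> (z * z)) y = 2 *\<^sub>R (grad \<phi> (y * y) * y)"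
proof (rule grad_eqI)
  have sq: "((\<lambda>z. z * z) has_derivative (\<lambda>h. y * h + h * y)) (at y)"
    by (rule bounded_bilinear.FDERIV[OF bounded_bilinear_vec_mult has_derivative_ident has_derivative_ident])
  have "(\<phi> has_derivative (\<lambda>h. inner h (grad \<phi> (y * y)))) (at (y * y))"
    using GDERIV_grad[OF assms] by (simp add: gderiv_def)
  from has_derivative_compose[OF sq this]
  have "((\<lambda>z. \<phi> (z * z)) has_derivative (\<lambda>h. inner (y * h + h * y) (grad \<phi> (y * y)))) (at y)" .
  moreover have "inner (y * h + h * y) (grad \<phi> (y * y)) = inner h (2 *\<^sub>R (grad \<phi> (y * y) * y))" for h
    by (simp add: inner_vec_def sum_distrib_left algebra_simps)
  ultimately show "GDERIV (\<lambda>z. \<phi> (z * z)) y :> 2 *\<^sub>R (grad \<phi> (y * y) * y)"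
    by (simp add: gderiv_def)
qed

lemma first_order_stationary_iff_orthogonal_kernel:
  fixes \<phi> :: "real ^ 'n \<Rightarrow> real"
  assumes diff: "\<phi> differentiable (at (y * y))" and y: "y \<in> P_set A b"
  shows "first_order_stationary (\<lambda>z. \<phi> (z * z)) (P_set A b) y \<longleftrightarrow>
    grad \<phi> (y * y) * y \<in> (mat_kernel (A ** Diag y))\<^sup>\<bottom>"
    (is "?stat \<longleftrightarrow> ?g \<in> ?K\<^sup>\<bottom>")
proof -
  have stat: "?stat \<longleftrightarrow> (\<forall>h \<in> contingent_cone (P_set A b) y. inner ?g h \<ge> 0)"
    using y by (simp add: first_order_stationary_def grad_comp_square[OF diff])
  show ?thesis
  proof
    assume ?stat
    have ge: "inner ?g h \<ge> 0" if "h \<in> ?K" for h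
    proof -
      \<comment> \<open>The factor \<open>y\<close> in \<open>?g\<close> makes the discarded
        coordinates of \<open>h\<close> contribute nothing.\<close>
      have "inner ?g h = inner ?g (\<chi> i. if y $ i = 0 then 0 else h $ i)"
        by (auto simp: inner_vec_def intro!: sum.cong)
      then show ?thesis
        using \<open>?stat\<close> stat restrict_support_in_contingent_cone[OF y that] by simp
    qed
    have "inner h ?g = 0" if "h \<in> ?K" for h
    proof -
      have "- h \<in> ?K"
        using that by (simp add: mat_kernel_def mult_Diag_mult_vec linear_neg[OF matrix_vector_mul_linear])
      then show ?thesis
        using ge[OF that] ge[of "- h"] by (simp add: inner_commute)
    qed
    then show "?g \<in> ?K\<^sup>\<bottom>"
      by (simp add: orthogonal_comp_def orthogonal_def)
  next
    assume "?g \<in> ?K\<^sup>\<bottom>"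
    then show ?stat
      unfolding stat using contingent_cone_P_set_subset[OF y]
      by (auto simp: orthogonal_comp_def orthogonal_def inner_commute)
  qed
qed

text \<open>As \<open>lam\<close> varies, \<open>transpose_rows_mult r M lam\<close> runs through
  the range of \<open>A ** Diag y\<close>, and its image under \<open>Diag y ** transpose A\<close>
  is already the full range of that matrix.\<close>

lemma multiplier_iff_mat_range:
  fixes A :: "real ^ 'n ^ 'm"
  assumes "rows_form_basis r M (mat_range (A ** Diag y))"
  shows "(\<exists>lam. (v - transpose A *v transpose_rows_mult r M lam) * y = 0) \<longleftrightarrow>
    v * y \<in> mat_range (Diag y ** transpose A)"
proof -
  have tr: "Diag y ** transpose A = transpose (A ** Diag y)"
    by (simp add: matrix_transpose_mul transpose_Diag)
  have "range (transpose_rows_mult r M) = mat_range (A ** Diag y)"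
    using assms span_image_lessThan_eq_range_sum[of M r]
    by (simp add: rows_form_basis_def transpose_rows_mult_def[abs_def])
  then have "mat_range (Diag y ** transpose A) =
      range (\<lambda>lam. (Diag y ** transpose A) *v transpose_rows_mult r M lam)"
    unfolding tr transpose_image_mat_range[symmetric] by (metis image_image)
  moreover have "(v - w) * y = 0 \<longleftrightarrow> v * y = y * w" for w
    by (simp add: algebra_simps)
  ultimately show ?thesis
    by (auto simp: image_iff matrix_vector_mul_assoc[symmetric] Diag_mult_vec)
qed

theorem lemma1:
  fixes \<phi> :: "real ^ 'n \<Rightarrow> real"
    and A :: "real ^ 'n ^ 'm"
    and b :: "real ^ 'm"
    and f :: "real ^ 'n \<Rightarrow> real"
    and x y :: "real ^ 'n"
    and M N :: "nat \<Rightarrow> real ^ 'm"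
    and r :: nat
  assumes "continuously_differentiable \<phi>"
    and "rank A = CARD('m)"
    and "{z. (\<forall>i. z $ i \<ge> 0) \<and> A *v z = b} \<noteq> {}"
    and "\<And>z. f z = \<phi> (z * z)"
    and "y \<in> P_set A b"
    and "regular_representation A y M N r"
    and "x = y * y"
  shows "(first_order_stationary f (P_set A b) y \<longleftrightarrow>
            (\<exists>lam :: nat \<Rightarrow> real.
               (grad \<phi> x - transpose A *v transpose_rows_mult r M lam) * y = 0))
       \<and> ((\<exists>lam :: nat \<Rightarrow> real.
               (grad \<phi> x - transpose A *v transpose_rows_mult r M lam) * y = 0) \<longleftrightarrow>
            grad \<phi> x * y \<in> mat_range (Diag y ** transpose A))
       \<and> (grad \<phi> x * y \<in> mat_range (Diag y ** transpose A) \<longleftrightarrow>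
            closest_point (mat_kernel (A ** Diag y)) (grad \<phi> x * y) = 0)"
proof -
  let ?g = "grad \<phi> x * y" and ?B = "A ** Diag y"
  have f: "f = (\<lambda>z. \<phi> (z * z))"
    using assms(4) by blast
  have "\<phi> differentiable (at (y * y))"
    using assms(1) by (simp add: continuously_differentiable_def)
  then have "first_order_stationary f (P_set A b) y \<longleftrightarrow> ?g \<in> (mat_kernel ?B)\<^sup>\<bottom>"
    unfolding f assms(7) using assms(5) by (rule first_order_stationary_iff_orthogonal_kernel)
  \<comment> \<open>All the conditions meet here: each amounts to \<open>?g\<close> being orthogonal
    to the kernel of \<open>?B\<close>.\<close>
  moreover have "mat_range (Diag y ** transpose A) = (mat_kernel ?B)\<^sup>\<bottom>"
    using mat_range_transpose_eq_orthogonal_comp[of ?B]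
    by (simp add: matrix_transpose_mul transpose_Diag)
  moreover have "subspace (mat_kernel ?B)"
    unfolding mat_kernel_eq_orthogonal_comp by (rule subspace_orthogonal_comp)
  moreover have "rows_form_basis r M (mat_range ?B)"
    using assms(6) unfolding regular_representation_def by blast
  ultimately show ?thesis
    using multiplier_iff_mat_range closest_point_subspace_eq_0_iff by metis
qed

end
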